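(* Let $(\mathcal{M},[\cdot,\cdot])$ be a Banach--Malcev algebra and let $\alpha:\mathcal{M}\to\mathcal{M}$ be an isometric Malcev algebra automorphism. Put $[x,y]_\alpha:=\alpha([x,y])$. Then $(\mathcal{M},[\cdot,\cdot]_\alpha,\alpha)$ is a Hom--Banach--Malcev algebra and $\|[x,y]_\alpha\|=\|[x,y]\|$ for all $x,y\in\mathcal{M}$.
   Context: A Malcev bracket on a complex vector space is a bilinear skew-symmetric bracket satisfying the Malcev identity $J(x,y,[x,z])=[J(x,y,z),x]$, where $J(x,y,z)=[x,[y,z]]+[y,[z,x]]+[z,[x,y]]$. A Banach--Malcev algebra is a complex Banach space with a continuous Malcev bracket. A Malcev algebra automorphism is a linear bijection $\alpha$ with $\alpha([x,y])=[\alpha(x),\alpha(y)]$ for all $x,y$. A Hom--Banach--Malcev algebra $(\mathcal{M},[\cdot,\cdot]_\alpha,\alpha)$ is a complex Banach space $\mathcal{M}$ with a bounded linear map $\alpha$ and a continuous bilinear bracket $[\cdot,\cdot]_\alpha$ such that $[x,y]_\alpha=\alpha([x,y])$ for a continuous Malcev bracket $[\cdot,\cdot]$ on $\mathcal{M}$, and such that the Hom--Malcev identity \[ J_\alpha(\alpha(x),\alpha(y),[x,z]_\alpha)=[J_\alpha(x,y,z),\alpha^2(x)]_\alpha \] holds for all $x,y,z$, where $J_\alpha(x,y,z):=[\alpha(x),[y,z]_\alpha]_\alpha+[\alpha(y),[z,x]_\alpha]_\alpha+[\alpha(z),[x,y]_\alpha]_\alpha$. *)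

theory Defs
  imports "HOL-Analysis.Analysis"
begin

text \<open>
  Complex Banach spaces. The real structure inherited from \<^class>\<open>banach\<close> is required to be
  the restriction of scalars of the complex one; in particular \<open>1 *\<^sub>C x = x\<close> is derivable.
\<close>

class complex_banach = banach +
  fixes scaleC :: "complex \<Rightarrow> 'a \<Rightarrow> 'a" (infixr \<open>*\<^sub>C\<close> 75)
  assumes scaleC_add_right: "c *\<^sub>C (x + y) = c *\<^sub>C x + c *\<^sub>C y"
    and scaleC_add_left: "(c + d) *\<^sub>C x = c *\<^sub>C x + d *\<^sub>C x"
    and scaleC_scaleC: "c *\<^sub>C d *\<^sub>C x = (c * d) *\<^sub>C x"
    and scaleC_complex_of_real: "complex_of_real r *\<^sub>C x = r *\<^sub>R x"
    and norm_scaleC: "norm (c *\<^sub>C x) = cmod c * norm x"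

lemma vector_space_scaleC:
  "vector_space (scaleC :: complex \<Rightarrow> 'a \<Rightarrow> 'a::complex_banach)"
proof
  show "1 *\<^sub>C x = x" for x :: 'a
    using scaleC_complex_of_real[of 1 x] by simp
qed (simp_all add: scaleC_add_right scaleC_add_left scaleC_scaleC)

instantiation complex :: complex_banach
begin

definition scaleC_complex :: "complex \<Rightarrow> complex \<Rightarrow> complex"
  where "scaleC_complex c x = c * x"

instance
  by standard (simp_all add: scaleC_complex_def algebra_simps norm_mult scaleR_conv_of_real)

end

abbreviation complex_linear :: "('a::complex_banach \<Rightarrow> 'b::complex_banach) \<Rightarrow> bool"
  where "complex_linear \<equiv> Vector_Spaces.linear scaleC scaleC"

definition complex_bilinear ::
    "('a::complex_banach \<Rightarrow> 'b::complex_banach \<Rightarrow> 'c::complex_banach) \<Rightarrow> bool"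
  where "complex_bilinear b \<longleftrightarrow>
    (\<forall>x. complex_linear (\<lambda>y. b x y)) \<and> (\<forall>y. complex_linear (\<lambda>x. b x y))"

definition jacobian :: "('a::complex_banach \<Rightarrow> 'a \<Rightarrow> 'a) \<Rightarrow> 'a \<Rightarrow> 'a \<Rightarrow> 'a \<Rightarrow> 'a"
  where "jacobian br x y z = br x (br y z) + br y (br z x) + br z (br x y)"

definition malcev_bracket :: "('a::complex_banach \<Rightarrow> 'a \<Rightarrow> 'a) \<Rightarrow> bool"
  where "malcev_bracket br \<longleftrightarrow>
    complex_bilinear br \<and>
    (\<forall>x y. br x y = - br y x) \<and>
    (\<forall>x y z. jacobian br x y (br x z) = br (jacobian br x y z) x)"

text \<open>Continuity of a bracket always means joint continuity on the product.\<close>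

definition banach_malcev_algebra :: "('a::complex_banach \<Rightarrow> 'a \<Rightarrow> 'a) \<Rightarrow> bool"
  where "banach_malcev_algebra br \<longleftrightarrow>
    malcev_bracket br \<and> continuous_on UNIV (\<lambda>(x, y). br x y)"

definition malcev_automorphism ::
    "('a::complex_banach \<Rightarrow> 'a \<Rightarrow> 'a) \<Rightarrow> ('a \<Rightarrow> 'a) \<Rightarrow> bool"
  where "malcev_automorphism br \<alpha> \<longleftrightarrow>
    complex_linear \<alpha> \<and> bij \<alpha> \<and> (\<forall>x y. \<alpha> (br x y) = br (\<alpha> x) (\<alpha> y))"

definition isometric :: "('a::metric_space \<Rightarrow> 'b::metric_space) \<Rightarrow> bool"
  where "isometric f \<longleftrightarrow> (\<forall>x y. dist (f x) (f y) = dist x y)"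

definition twisted_bracket :: "('a \<Rightarrow> 'a) \<Rightarrow> ('a \<Rightarrow> 'a \<Rightarrow> 'a) \<Rightarrow> 'a \<Rightarrow> 'a \<Rightarrow> 'a"
  where "twisted_bracket \<alpha> br x y = \<alpha> (br x y)"

text \<open>
  In the next two definitions \<open>br\<alpha>\<close> is the Hom-bracket itself, not the Malcev bracket
  it is twisted from.
\<close>

definition hom_jacobian ::
    "('a::complex_banach \<Rightarrow> 'a \<Rightarrow> 'a) \<Rightarrow> ('a \<Rightarrow> 'a) \<Rightarrow> 'a \<Rightarrow> 'a \<Rightarrow> 'a \<Rightarrow> 'a"
  where "hom_jacobian br\<alpha> \<alpha> x y z =
    br\<alpha> (\<alpha> x) (br\<alpha> y z) + br\<alpha> (\<alpha> y) (br\<alpha> z x) + br\<alpha> (\<alpha> z) (br\<alpha> x y)"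

definition hom_banach_malcev_algebra ::
    "('a::complex_banach \<Rightarrow> 'a \<Rightarrow> 'a) \<Rightarrow> ('a \<Rightarrow> 'a) \<Rightarrow> bool"
  where "hom_banach_malcev_algebra br\<alpha> \<alpha> \<longleftrightarrow>
    complex_linear \<alpha> \<and> bounded_linear \<alpha> \<and>
    complex_bilinear br\<alpha> \<and> continuous_on UNIV (\<lambda>(x, y). br\<alpha> x y) \<and>
    (\<exists>br. banach_malcev_algebra br \<and> br\<alpha> = twisted_bracket \<alpha> br) \<and>
    (\<forall>x y z. hom_jacobian br\<alpha> \<alpha> (\<alpha> x) (\<alpha> y) (br\<alpha> x z) =
      br\<alpha> (hom_jacobian br\<alpha> \<alpha> x y z) ((\<alpha> ^^ 2) x))"

end

theory Submission
  imports Defs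
begin

text \<open>
  Since \<open>\<alpha>\<close> commutes with the bracket, the Hom-Jacobian of the twisted bracket is \<open>\<alpha>\<^sup>2\<close> applied
  to the Jacobian, so the Hom-Malcev identity is \<open>\<alpha>\<^sup>3\<close> applied to the Malcev identity.
\<close>

text \<open>A linear map fixes 0, so preserving the distance to 0 is preserving the norm. This gives
  both the boundedness of \<alpha> and the final norm equality.\<close>

lemma complex_linear_isometric_norm:
  assumes "complex_linear f" "isometric f"
  shows "norm (f x) = norm x"
proof -
  interpret Vector_Spaces.linear scaleC scaleC f by fact
  from assms(2) have "dist (f x) (f 0) = dist x 0" unfolding isometric_def by blast
  then show ?thesis by (simp add: zero)
qed

lemma complex_linear_isometric_bounded_linear:
  assumes "complex_linear f" "isometric f"
  shows "bounded_linear f"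
proof -
  interpret Vector_Spaces.linear scaleC scaleC f by fact
  show ?thesis
  proof (rule bounded_linear_intro[where K = 1])
    show "f (x + y) = f x + f y" for x y by (rule add)
    show "f (r *\<^sub>R x) = r *\<^sub>R f x" for r x
      \<comment> \<open>Real homogeneity is complex homogeneity at a real scalar, since the two
        scalar actions agree there.\<close>
      using scale[of "complex_of_real r" x] by (simp add: scaleC_complex_of_real)
    show "norm (f x) \<le> norm x * 1" for x
      by (simp add: complex_linear_isometric_norm[OF assms])
  qed
qed

lemma complex_bilinear_twisted_bracket:
  assumes "complex_linear \<alpha>" "complex_bilinear br"
  shows "complex_bilinear (twisted_bracket \<alpha> br)"
  using assms Vector_Spaces.linear_compose[of scaleC scaleC _ scaleC \<alpha>]
  by (auto simp: complex_bilinear_def twisted_bracket_def o_def)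

lemma jacobian_automorphism:
  assumes "malcev_automorphism br \<alpha>"
  shows "jacobian br (\<alpha> x) (\<alpha> y) (\<alpha> z) = \<alpha> (jacobian br x y z)"
proof -
  interpret Vector_Spaces.linear scaleC scaleC \<alpha>
    using assms by (simp add: malcev_automorphism_def)
  from assms have "br (\<alpha> u) (\<alpha> v) = \<alpha> (br u v)" for u v
    by (simp add: malcev_automorphism_def)
  then show ?thesis by (simp add: jacobian_def add)
qed

text \<open>In each summand the outer twisted bracket supplies one \<alpha>. Its two arguments, such
  as \<open>\<alpha> x\<close> and \<open>\<alpha> (br y z)\<close>, are both images under \<alpha>,
  so a second \<alpha> comes out of \<open>br\<close>.\<close>

lemma hom_jacobian_twisted_bracket:
  assumes "malcev_automorphism br \<alpha>"
  shows "hom_jacobian (twisted_bracket \<alpha> br) \<alpha> x y z = \<alpha> (\<alpha> (jacobian br x y z))"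
proof -
  interpret Vector_Spaces.linear scaleC scaleC \<alpha>
    using assms by (simp add: malcev_automorphism_def)
  from assms have "br (\<alpha> u) (\<alpha> v) = \<alpha> (br u v)" for u v
    by (simp add: malcev_automorphism_def)
  then show ?thesis by (simp add: hom_jacobian_def jacobian_def twisted_bracket_def add)
qed

lemma hom_malcev_identity_twisted_bracket:
  assumes "malcev_bracket br" and aut: "malcev_automorphism br \<alpha>"
  shows "hom_jacobian (twisted_bracket \<alpha> br) \<alpha> (\<alpha> x) (\<alpha> y) (twisted_bracket \<alpha> br x z) =
    twisted_bracket \<alpha> br (hom_jacobian (twisted_bracket \<alpha> br) \<alpha> x y z) ((\<alpha> ^^ 2) x)"
proof -
  from aut have hom: "\<alpha> (br u v) = br (\<alpha> u) (\<alpha> v)" for u v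
    by (simp add: malcev_automorphism_def)
  \<comment> \<open>The third argument is \<open>\<alpha> (br x z)\<close>, so all three arguments
    are images under \<alpha> and the inner Jacobian yields the third \<alpha>.\<close>
  have "hom_jacobian (twisted_bracket \<alpha> br) \<alpha> (\<alpha> x) (\<alpha> y) (twisted_bracket \<alpha> br x z) =
      \<alpha> (\<alpha> (\<alpha> (jacobian br x y (br x z))))"
    unfolding hom_jacobian_twisted_bracket[OF aut] twisted_bracket_def
      jacobian_automorphism[OF aut] ..
  also have "jacobian br x y (br x z) = br (jacobian br x y z) x"
    using assms(1) unfolding malcev_bracket_def by blast
  finally show ?thesis
    unfolding hom_jacobian_twisted_bracket[OF aut]
    \<comment> \<open>Pushing every \<alpha> inwards turns both sides into \<open>br\<close> of the
      threefold images of the Jacobian and of \<open>x\<close>.\<close>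
    by (simp add: twisted_bracket_def eval_nat_numeral hom)
qed

theorem proposition3p6:
  fixes br :: "'a::complex_banach \<Rightarrow> 'a \<Rightarrow> 'a" and \<alpha> :: "'a \<Rightarrow> 'a"
  assumes "banach_malcev_algebra br"
    and "malcev_automorphism br \<alpha>"
    and "isometric \<alpha>"
  shows "hom_banach_malcev_algebra (twisted_bracket \<alpha> br) \<alpha> \<and>
    (\<forall>x y. norm (twisted_bracket \<alpha> br x y) = norm (br x y))"
proof -
  from assms(1) have br: "malcev_bracket br" "complex_bilinear br"
    and cont: "continuous_on UNIV (\<lambda>(x, y). br x y)"
    unfolding banach_malcev_algebra_def malcev_bracket_def by blast+
  from assms(2) have lin: "complex_linear \<alpha>" by (simp add: malcev_automorphism_def)
  note bounded = complex_linear_isometric_bounded_linear[OF lin assms(3)]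
  have "continuous_on UNIV (\<lambda>(x, y). twisted_bracket \<alpha> br x y)"
    using bounded_linear.continuous_on[OF bounded cont]
    unfolding twisted_bracket_def case_prod_unfold .
  then have "hom_banach_malcev_algebra (twisted_bracket \<alpha> br) \<alpha>"
    unfolding hom_banach_malcev_algebra_def
    \<comment> \<open>The untwisted bracket demanded by the definition is \<open>br\<close>
      itself.\<close>
    using lin bounded assms(1) complex_bilinear_twisted_bracket[OF lin br(2)]
      hom_malcev_identity_twisted_bracket[OF br(1) assms(2)]
    by blast
  then show ?thesis
    \<comment> \<open>The norm equality is norm preservation of \<alpha> at the vector
      \<open>br x y\<close>.\<close>
    by (simp add: twisted_bracket_def complex_linear_isometric_norm[OF lin assms(3)])
qed

end
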